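(* Let $\alpha\ge \frac{\sqrt2\,\sqrt[4]{3}}{\sqrt{\pi}}$. There exist $c>0$ and $n_0$, depending only on $\alpha$, such that every generic $\alpha$-dense set $P$ of $n\ge n_0$ points in the plane satisfies $\operatorname{cr}(P)\ge cn$.
   Context: A set $P$ of $n$ points in the plane, rescaled so that its minimum pairwise distance is $1$, is $\alpha$-dense if its diameter is less than $\alpha\sqrt n$. A finite planar point set is in general position if no three of its points are collinear; it is generic if it is in general position and every subset has a unique Euclidean minimum spanning tree (MST). For a generic set $X$, $T_X$ denotes its MST, drawn with straight-line edges. For disjoint $R,B$ with $R\cup B$ generic, $\operatorname{cr}(R,B)$ is the number of crossings between the edges of $T_R$ and the edges of $T_B$, and for generic $P$, $\operatorname{cr}(P)=\max\operatorname{cr}(R,B)$ over all partitions $P=R\cup B$ into two disjoint sets. *)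

theory Defs
  imports "HOL-Analysis.Analysis"
begin

type_synonym point = "real \<times> real"
type_synonym edge = "point set"   (* an edge is a 2-element set {a,b} *)

definition min_dist :: "point set \<Rightarrow> real" where
  "min_dist P = Min {dist p q | p q. p \<in> P \<and> q \<in> P \<and> p \<noteq> q}"

text \<open>alpha-dense: after rescaling to minimum pairwise distance 1, the diameter
  is less than alpha * sqrt n; i.e. diameter P < alpha * sqrt n * min_dist P.\<close>
definition alpha_dense :: "real \<Rightarrow> point set \<Rightarrow> bool" where
  "alpha_dense \<alpha> P \<longleftrightarrow> finite P \<and> card P \<ge> 2 \<and>
     diameter P < \<alpha> * sqrt (real (card P)) * min_dist P"

definition general_position :: "point set \<Rightarrow> bool" where
  "general_position P \<longleftrightarrow> (\<forall>S \<subseteq> P. card S = 3 \<longrightarrow> \<not> collinear S)"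

definition adj :: "edge set \<Rightarrow> (point \<times> point) set" where
  "adj E = {(a, b). {a, b} \<in> E}"

text \<open>Spanning tree of the complete geometric graph on X: edges are 2-subsets
  of X, the graph (X,E) is connected, and |E| = |X| - 1.\<close>
definition spanning_tree :: "point set \<Rightarrow> edge set \<Rightarrow> bool" where
  "spanning_tree X E \<longleftrightarrow>
     E \<subseteq> {{a, b} | a b. a \<in> X \<and> b \<in> X \<and> a \<noteq> b} \<and>
     (\<forall>a\<in>X. \<forall>b\<in>X. (a, b) \<in> (adj E)\<^sup>*) \<and>
     card E = card X - 1"

definition weight :: "edge set \<Rightarrow> real" where
  "weight E = (\<Sum>e\<in>E. diameter e)"   (* diameter {a,b} = dist a b *)

definition is_MST :: "point set \<Rightarrow> edge set \<Rightarrow> bool" where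
  "is_MST X E \<longleftrightarrow> spanning_tree X E \<and>
     (\<forall>E'. spanning_tree X E' \<longrightarrow> weight E \<le> weight E')"

definition generic :: "point set \<Rightarrow> bool" where
  "generic P \<longleftrightarrow> finite P \<and> general_position P \<and> (\<forall>Y \<subseteq> P. \<exists>!E. is_MST Y E)"

definition MST :: "point set \<Rightarrow> edge set" where
  "MST X = (THE E. is_MST X E)"

text \<open>Number of crossings between the straight-line edges of T_R and T_B.\<close>
definition cr2 :: "point set \<Rightarrow> point set \<Rightarrow> nat" where
  "cr2 R B = card {(e, f). e \<in> MST R \<and> f \<in> MST B \<and> convex hull e \<inter> convex hull f \<noteq> {}}"

definition cr :: "point set \<Rightarrow> nat" where
  "cr P = Max {cr2 R (P - R) | R. R \<subseteq> P}"

end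

theory Submission
  imports Defs
begin

text \<open>
  Colour blue only far apart pairs \<open>{l, r}\<close> of points at bounded distance (relative to the minimum
  distance), and everything else red. Each pair is an edge of the blue MST, as \<open>r\<close> is the blue point
  nearest to \<open>l\<close>; and every edge of the MST \<open>T\<close> of the whole set with two red ends survives in the
  red MST. So it suffices to find linearly many places where an edge of \<open>T\<close> crosses a short segment
  between two other points.

  Such a place is given by two triangles that form a hexagram, neither containing a vertex of the
  other, with a point of the set in their intersection: \<open>T\<close> has an edge that leaves the
  intersection, and it crosses a side of one of the triangles. A 9 by 9 grid of nonempty square
  cells contains a hexagram. A square of side proportional to \<open>9 ^ k\<close> without such a grid at any scale
  has at most \<open>80 ^ k\<close> points, as one of the 81 subsquares is empty at each level. Since
  \<open>80 ^ k / 81 ^ k\<close> tends to 0 and the set is dense, for a suitable \<open>k\<close> at least half of the points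
  lie in squares that do contain a grid, and there are linearly many of these.
\<close>

subsection \<open>Exchange properties of minimum spanning trees\<close>

lemma adj_iff: "(a, b) \<in> adj E \<longleftrightarrow> {a, b} \<in> E"
  by (simp add: adj_def)

lemma adj_insert: "adj (insert {x, y} F) = insert (x, y) (insert (y, x) (adj F))"
  by (auto simp: adj_def doubleton_eq_iff)

lemma adj_mono: "E \<subseteq> F \<Longrightarrow> adj E \<subseteq> adj F"
  by (auto simp: adj_def)

lemma adj_rtrancl_sym: "(a, b) \<in> (adj E)\<^sup>* \<Longrightarrow> (b, a) \<in> (adj E)\<^sup>*"
  using symD[OF sym_rtrancl[of "adj E"]] by (auto simp: adj_def sym_def insert_commute)

text \<open>The new edge contributes two ordered pairs, so \<open>rtrancl_insert\<close> applies
  twice. A walk using both orientations returns to the side it came from and collapses into a walk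
  in \<open>F\<close> by symmetry.\<close>

lemma reach_insert_cases:
  assumes "(a, b) \<in> (adj (insert {x, y} F))\<^sup>*"
  shows "(a, b) \<in> (adj F)\<^sup>* \<or> ((a, x) \<in> (adj F)\<^sup>* \<and> (y, b) \<in> (adj F)\<^sup>*)
    \<or> ((a, y) \<in> (adj F)\<^sup>* \<and> (x, b) \<in> (adj F)\<^sup>*)"
  using assms adj_rtrancl_sym[of _ _ F]
  unfolding adj_insert rtrancl_insert by (auto intro: rtrancl_trans)

lemma reach_leaves_set:
  assumes "(p, q) \<in> (adj E)\<^sup>*" "p \<in> A" "q \<notin> A"
  obtains u v where "u \<in> A" "v \<notin> A" "{u, v} \<in> E"
proof -
  have "\<exists>u v. u \<in> A \<and> v \<notin> A \<and> {u, v} \<in> E"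
    using assms
  proof (induction rule: rtrancl_induct)
    case (step y z)
    show ?case
    proof (cases "y \<in> A")
      case True
      then show ?thesis using step unfolding adj_iff by blast
    next
      case False
      then show ?thesis using step by blast
    qed
  qed blast
  then show ?thesis using that by blast
qed

text \<open>Induction on the edges: \<open>V\<close> holds points from pairwise different
  components, and a new edge merges at most two components, so dropping one representative
  suffices.\<close>

lemma separated_representatives:
  assumes "finite E" "finite X" "\<forall>e\<in>E. \<exists>x y. e = {x, y}"
  shows "\<exists>V\<subseteq>X. card X \<le> card V + card E \<and> (\<forall>a\<in>V. \<forall>b\<in>V. (a, b) \<in> (adj E)\<^sup>* \<longrightarrow> a = b)"
  using assms
proof (induction E rule: finite_induct)
  case empty
  have "(adj {})\<^sup>* = Id" by (simp add: adj_def)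
  then show ?case by auto
next
  case (insert e F)
  then obtain V where V: "V \<subseteq> X" "card X \<le> card V + card F"
      "\<forall>a\<in>V. \<forall>b\<in>V. (a, b) \<in> (adj F)\<^sup>* \<longrightarrow> a = b" by auto
  obtain x y where e: "e = {x, y}" using insert by auto
  \<comment> \<open>Dropping the representative of the component of \<open>x\<close> leaves nothing
    that the new edge could join. There is at most one, since \<open>V\<close> is separated.\<close>
  define V' where "V' = V - {a. (a, x) \<in> (adj F)\<^sup>*}"
  have fV: "finite V" using V insert finite_subset by blast
  have "card (V \<inter> {a. (a, x) \<in> (adj F)\<^sup>*}) \<le> 1"
  proof -
    have "\<forall>a\<in>V \<inter> {a. (a, x) \<in> (adj F)\<^sup>*}. \<forall>b\<in>V \<inter> {a. (a, x) \<in> (adj F)\<^sup>*}. a = b"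
    proof (intro ballI)
      fix a b
      assume a: "a \<in> V \<inter> {a. (a, x) \<in> (adj F)\<^sup>*}" and b: "b \<in> V \<inter> {a. (a, x) \<in> (adj F)\<^sup>*}"
      then have "(a, x) \<in> (adj F)\<^sup>*" "(x, b) \<in> (adj F)\<^sup>*" using adj_rtrancl_sym[of b x F] by simp_all
      then show "a = b" using V(3) a b rtrancl_trans[of a x "adj F" b] by simp
    qed
    then show ?thesis using fV by (simp add: card_le_Suc0_iff_eq)
  qed
  then have "card V \<le> card V' + 1"
    unfolding V'_def using card_Diff_subset_Int[of V "{a. (a, x) \<in> (adj F)\<^sup>*}"] fV by simp
  then have "card X \<le> card V' + card (insert e F)" using V insert by simp
  moreover have "\<forall>a\<in>V'. \<forall>b\<in>V'. (a, b) \<in> (adj (insert e F))\<^sup>* \<longrightarrow> a = b"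
    proof (intro ballI impI)
    fix a b
    assume ab: "a \<in> V'" "b \<in> V'" "(a, b) \<in> (adj (insert e F))\<^sup>*"
    then have "(a, x) \<notin> (adj F)\<^sup>*" "(x, b) \<notin> (adj F)\<^sup>*"
      using adj_rtrancl_sym[of x b F] by (simp_all add: V'_def) blast
    then have "(a, b) \<in> (adj F)\<^sup>*" using reach_insert_cases[OF ab(3)[unfolded e]] by simp
    then show "a = b" using V(3) ab by (simp add: V'_def)
  qed
  moreover have "V' \<subseteq> X" using V(1) by (simp add: V'_def subset_eq)
  ultimately show ?case by blast
qed

text \<open>Spanning trees are defined here by connectivity and edge count. This bound replaces
  acyclicity: removing an edge of a spanning tree must disconnect it.\<close>

lemma card_le_of_connected:
  assumes "finite E" "finite X" "\<forall>e\<in>E. \<exists>x y. e = {x, y}"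
    and "\<forall>a\<in>X. \<forall>b\<in>X. (a, b) \<in> (adj E)\<^sup>*"
  shows "card X \<le> card E + 1"
proof -
  obtain V where V: "V \<subseteq> X" "card X \<le> card V + card E"
      "\<forall>a\<in>V. \<forall>b\<in>V. (a, b) \<in> (adj E)\<^sup>* \<longrightarrow> a = b"
    using separated_representatives[OF assms(1-3)] by blast
  have "card V \<le> 1"
    using V(1,3) assms(2,4) finite_subset[OF V(1)] card_le_Suc0_iff_eq[of V]
    by (metis One_nat_def subsetD)
  then show ?thesis using V by simp
qed

lemma spanning_tree_finite:
  assumes "spanning_tree X E" "finite X"
  shows "finite E"
proof -
  have "E \<subseteq> Pow X" using assms by (auto simp: spanning_tree_def)
  then show ?thesis using assms finite_subset by auto
qed

lemma spanning_tree_edge: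
  assumes "spanning_tree X E" "e \<in> E"
  shows "\<exists>x y. e = {x, y} \<and> x \<in> X \<and> y \<in> X \<and> x \<noteq> y"
  using assms unfolding spanning_tree_def by blast

text \<open>The removed edge is replaced by the detour from \<open>x\<close> to \<open>u\<close>,
  over the new edge to \<open>v\<close>, and on to \<open>y\<close>. The condition on
  \<open>{u, v}\<close> still admits \<open>{u, v} = {x, y}\<close>, the trivial exchange, so that
  callers need not exclude it.\<close>

lemma spanning_tree_exchange:
  assumes T: "spanning_tree X E" and X: "finite X" and f: "{x, y} \<in> E"
    and uv: "u \<in> X" "v \<in> X" "u \<noteq> v" "{u, v} \<notin> E - {{x, y}}"
    and ux: "(u, x) \<in> (adj (E - {{x, y}}))\<^sup>*" and yv: "(y, v) \<in> (adj (E - {{x, y}}))\<^sup>*"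
  shows "spanning_tree X (insert {u, v} (E - {{x, y}}))"
proof -
  let ?E = "insert {u, v} (E - {{x, y}})"
  have fin: "finite E" using T X by (rule spanning_tree_finite)
  have sub: "(adj (E - {{x, y}}))\<^sup>* \<subseteq> (adj ?E)\<^sup>*" by (intro rtrancl_mono adj_mono) auto
  have "(u, v) \<in> (adj ?E)\<^sup>*" by (auto simp: adj_def)
  then have xy: "(x, y) \<in> (adj ?E)\<^sup>*"
    using ux yv sub adj_rtrancl_sym by (meson rtrancl_trans subsetD)
  have "(a, b) \<in> (adj ?E)\<^sup>*" if "{a, b} \<in> E" for a b
  proof (cases "{a, b} = {x, y}")
    case True
    then show ?thesis using xy adj_rtrancl_sym[OF xy] by (auto simp: doubleton_eq_iff)
  next
    case False
    then have "(a, b) \<in> adj ?E" using that by (auto simp: adj_def)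
    then show ?thesis by (rule r_into_rtrancl)
  qed
  then have "adj E \<subseteq> (adj ?E)\<^sup>*" by (auto simp: adj_def)
  then have "(adj E)\<^sup>* \<subseteq> (adj ?E)\<^sup>*" using rtrancl_subset_rtrancl by blast
  moreover have "card ?E = card E"
    using fin f uv(4) by (metis card_Suc_Diff1 card_insert_disjoint finite_Diff)
  moreover have "?E \<subseteq> {{a, b} | a b. a \<in> X \<and> b \<in> X \<and> a \<noteq> b}"
  proof -
    have "{u, v} \<in> {{a, b} | a b. a \<in> X \<and> b \<in> X \<and> a \<noteq> b}" using uv(1-3) by blast
    then show ?thesis using T unfolding spanning_tree_def by simp blast
  qed
  moreover have "card E = card X - 1" "\<forall>a\<in>X. \<forall>b\<in>X. (a, b) \<in> (adj E)\<^sup>*"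
    using T by (simp_all add: spanning_tree_def)
  ultimately have "\<forall>a\<in>X. \<forall>b\<in>X. (a, b) \<in> (adj ?E)\<^sup>*" "card ?E = card X - 1"
      "?E \<subseteq> {{a, b} | a b. a \<in> X \<and> b \<in> X \<and> a \<noteq> b}"
    by (blast, simp, blast)
  then show ?thesis by (simp only: spanning_tree_def)
qed

lemma is_MST_exchange_le:
  assumes "is_MST X E" "finite X" "f \<in> E" "e \<notin> E - {f}" "spanning_tree X (insert e (E - {f}))"
  shows "diameter f \<le> diameter e"
    and "diameter f = diameter e \<Longrightarrow> is_MST X (insert e (E - {f}))"
proof -
  have fin: "finite E" using assms spanning_tree_finite by (auto simp: is_MST_def)
  have *: "weight (insert e (E - {f})) = weight E - diameter f + diameter e"
    unfolding weight_def using fin assms(3,4) by (simp add: sum_diff1)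
  have "weight E \<le> weight (insert e (E - {f}))" using assms(1,5) by (simp add: is_MST_def)
  then show "diameter f \<le> diameter e" using * by simp
  show "is_MST X (insert e (E - {f}))" if "diameter f = diameter e"
    using assms(1,5) * that unfolding is_MST_def by simp
qed

text \<open>The cut property. A tree path from \<open>u\<close> to \<open>v\<close> crosses the cut
  in some edge \<open>{x, y}\<close>, which can be exchanged for \<open>{u, v}\<close>. As
  \<open>{u, v}\<close> may tie with other edges across the cut, the contradiction comes from
  uniqueness: the exchange would give a second MST.\<close>

lemma min_cut_edge_in_MST:
  assumes E: "is_MST X E" and uniq: "\<And>E'. is_MST X E' \<Longrightarrow> E' = E" and X: "finite X"
    and u: "u \<in> X" "u \<in> A" and v: "v \<in> X" "v \<notin> A"
    and min: "\<And>x y. x \<in> X \<Longrightarrow> x \<in> A \<Longrightarrow> y \<in> X \<Longrightarrow> y \<notin> A \<Longrightarrow> diameter {u, v} \<le> diameter {x, y}"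
  shows "{u, v} \<in> E"
proof (rule ccontr)
  assume nin: "{u, v} \<notin> E"
  have T: "spanning_tree X E" using E by (simp add: is_MST_def)
  have "E \<subseteq> E \<and> (u, v) \<in> (adj E)\<^sup>*" using T u v by (simp add: spanning_tree_def)
  \<comment> \<open>\<open>F\<close> is a path from \<open>u\<close> to \<open>v\<close>: the removal of any of its edges separates the two\<close>
  then obtain F where F: "F \<subseteq> E" "(u, v) \<in> (adj F)\<^sup>*"
      and Fmin: "\<And>F'. F' \<subseteq> E \<Longrightarrow> (u, v) \<in> (adj F')\<^sup>* \<Longrightarrow> card F \<le> card F'"
    using ex_has_least_nat[of "\<lambda>F. F \<subseteq> E \<and> (u, v) \<in> (adj F)\<^sup>*" E card] by blast
  obtain x y where xy: "x \<in> A" "y \<notin> A" "{x, y} \<in> F"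
    using reach_leaves_set[OF F(2)] u v by blast
  have xyX: "x \<in> X" "y \<in> X" using xy F T by (auto simp: spanning_tree_def doubleton_eq_iff)
  have finF: "finite F" using spanning_tree_finite[OF T X] F finite_subset by blast
  have "(u, v) \<notin> (adj (F - {{x, y}}))\<^sup>*"
  proof
    assume "(u, v) \<in> (adj (F - {{x, y}}))\<^sup>*"
    then have "card F \<le> card (F - {{x, y}})" using F by (intro Fmin) auto
    then show False using xy(3) finF by (metis card_Diff1_less not_le)
  qed
  moreover have "insert {x, y} (F - {{x, y}}) = F" using xy by auto
  moreover have sub: "(adj (F - {{x, y}}))\<^sup>* \<subseteq> (adj (E - {{x, y}}))\<^sup>*"
    using F by (intro rtrancl_mono adj_mono) auto
  ultimately have "((u, x) \<in> (adj (E - {{x, y}}))\<^sup>* \<and> (y, v) \<in> (adj (E - {{x, y}}))\<^sup>*) \<or>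
     ((u, y) \<in> (adj (E - {{x, y}}))\<^sup>* \<and> (x, v) \<in> (adj (E - {{x, y}}))\<^sup>*)"
    using F(2) reach_insert_cases[of u v x y "F - {{x, y}}"] by auto
  moreover have "{x, y} \<in> E" "{y, x} \<in> E" using xy F by (auto simp: insert_commute)
  ultimately have T': "spanning_tree X (insert {u, v} (E - {{x, y}}))"
    using spanning_tree_exchange[OF T X, of x y u v] spanning_tree_exchange[OF T X, of y x u v] nin u v
    by (auto simp: insert_commute)
  note exch = is_MST_exchange_le[OF E X \<open>{x, y} \<in> E\<close> _ T']
  have "diameter {x, y} = diameter {u, v}" using exch(1) nin min[of x y] xy xyX by force
  then have "insert {u, v} (E - {{x, y}}) = E" using exch(2) nin uniq by blast
  then show False using nin by blast
qed

lemma generic_MST: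
  assumes "generic P" "X \<subseteq> P"
  shows "is_MST X (MST X)" and "is_MST X E \<Longrightarrow> E = MST X" and "finite X"
proof -
  have ex1: "\<exists>!E. is_MST X E" using assms by (simp add: generic_def)
  show *: "is_MST X (MST X)" unfolding MST_def using ex1 by (rule theI')
  show "E = MST X" if "is_MST X E" using ex1 * that by blast
  show "finite X" using assms finite_subset by (auto simp: generic_def)
qed

text \<open>Removing \<open>{u, v}\<close> from the tree of \<open>P\<close> splits \<open>P\<close>
  into the side \<open>S\<close> of \<open>u\<close> and the side of \<open>v\<close>. By exchange,
  \<open>{u, v}\<close> is a shortest edge between the sides; it remains so among the points of
  \<open>X\<close>, and the cut property for \<open>X\<close> applies.\<close>

lemma MST_restrict:
  assumes gen: "generic P" and "X \<subseteq> P" and e: "{u, v} \<in> MST P" and uX: "u \<in> X" and vX: "v \<in> X"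
  shows "{u, v} \<in> MST X"
proof -
  let ?E = "MST P"
  let ?F = "?E - {{u, v}}"
  note P = generic_MST[OF gen subset_refl]
  note X = generic_MST[OF gen \<open>X \<subseteq> P\<close>]
  have T: "spanning_tree P ?E" using P(1) by (simp add: is_MST_def)
  have uv: "u \<in> P" "v \<in> P" "u \<noteq> v" using T e by (auto simp: spanning_tree_def doubleton_eq_iff)
  have fin: "finite ?E" using spanning_tree_finite[OF T P(3)] .
  define S where "S = {q. (u, q) \<in> (adj ?F)\<^sup>*}"
  have EF: "insert {u, v} ?F = ?E" using e by auto
  have reach: "(u, q) \<in> (adj ?F)\<^sup>* \<or> (v, q) \<in> (adj ?F)\<^sup>*" if "q \<in> P" for q
  proof -
    have "(u, q) \<in> (adj (insert {u, v} ?F))\<^sup>*" using T uv that EF by (simp add: spanning_tree_def)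
    from reach_insert_cases[OF this] show ?thesis by auto
  qed
  \<comment> \<open>If \<open>v\<close> were still reachable from \<open>u\<close>, then
    \<open>?F\<close> would connect \<open>P\<close> with one edge too few.\<close>
  have vS: "v \<notin> S"
  proof
    assume "v \<in> S"
    then have "(u, v) \<in> (adj ?F)\<^sup>*" by (simp add: S_def)
    then have uq: "(u, q) \<in> (adj ?F)\<^sup>*" if "q \<in> P" for q
      using reach[OF that] rtrancl_trans[of u v "adj ?F" q] by blast
    have "\<forall>a\<in>P. \<forall>b\<in>P. (a, b) \<in> (adj ?F)\<^sup>*"
      using adj_rtrancl_sym[OF uq] uq rtrancl_trans by (metis (lifting))
    moreover have "\<forall>e\<in>?F. \<exists>x y. e = {x, y}" using spanning_tree_edge[OF T] by blast
    ultimately have "card P \<le> card ?F + 1" using fin P(3) by (intro card_le_of_connected) auto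
    moreover have "card ?F < card ?E" using card_Diff1_less[OF fin e] .
    ultimately show False using T by (simp add: spanning_tree_def)
  qed
  have "diameter {u, v} \<le> diameter {p, q}" if pq: "p \<in> P" "p \<in> S" "q \<in> P" "q \<notin> S" for p q
  proof -
    have vq: "(v, q) \<in> (adj ?F)\<^sup>*" using reach[of q] pq by (auto simp: S_def)
    have pu: "(p, u) \<in> (adj ?F)\<^sup>*" using pq adj_rtrancl_sym[of u p] by (simp add: S_def)
    have nin: "{p, q} \<notin> ?F"
    proof
      assume "{p, q} \<in> ?F"
      then have "(p, q) \<in> adj ?F" by (simp only: adj_iff)
      then show False using pq rtrancl_into_rtrancl[of u p "adj ?F" q] by (simp add: S_def)
    qed
    show ?thesis
      using spanning_tree_exchange[OF T P(3) e pq(1,3) _ nin pu vq] pq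
      by (intro is_MST_exchange_le(1)[OF P(1,3) e nin]) auto
  qed
  then show ?thesis
    using \<open>X \<subseteq> P\<close> uX vX vS
    by (intro min_cut_edge_in_MST[OF X(1,2,3), where A = S]) (simp_all add: S_def subset_eq)
qed

section \<open>Nearest neighbours in minimum spanning trees\<close>

lemma diameter_doubleton: "diameter {a, b} = dist a (b :: 'a :: euclidean_space)"
proof -
  have "diameter {a, b} \<le> dist a b"
    by (rule diameter_le) (auto simp: dist_norm norm_minus_commute)
  moreover have "dist a b \<le> diameter {a, b}"
    by (rule diameter_bounded_bound) auto
  ultimately show ?thesis by simp
qed

text \<open>The cut property for the cut that isolates \<open>l\<close>.\<close>

lemma nearest_neighbour_in_MST:
  assumes "generic P" "X \<subseteq> P" "l \<in> X" "r \<in> X" "l \<noteq> r"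
    and "\<And>x. x \<in> X \<Longrightarrow> x \<noteq> l \<Longrightarrow> dist l r \<le> dist l x"
  shows "{l, r} \<in> MST X"
proof (rule min_cut_edge_in_MST[OF generic_MST[OF assms(1,2)], where A = "{l}"])
  show "diameter {l, r} \<le> diameter {x, y}" if "x \<in> {l}" "y \<in> X" "y \<notin> {l}" for x y
    using assms(6)[of y] that by (simp add: diameter_doubleton)
qed (use assms(3-5) in simp_all)

subsection \<open>The hexagram\<close>

text \<open>Half-open squares anchored at the origin: they partition the plane, and the grids of
  sides \<open>w\<close> and \<open>9 * w\<close> are nested.\<close>

definition cell :: "real \<Rightarrow> point \<Rightarrow> int \<times> int" where
  "cell w p = (\<lfloor>fst p / w\<rfloor>, \<lfloor>snd p / w\<rfloor>)"

lemma cell_bounds: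
  assumes "w > 0"
  shows "cell w p = (i, j) \<longleftrightarrow> w * of_int i \<le> fst p \<and> fst p < w * of_int i + w
    \<and> w * of_int j \<le> snd p \<and> snd p < w * of_int j + w"
  using assms unfolding cell_def prod.inject floor_eq_iff
  by (auto simp: field_simps)

lemma convex_cell:
  assumes "w > 0"
  shows "convex {p. cell w p = c}"
proof -
  obtain i j where c: "c = (i, j)" by fastforce
  have "{p. cell w p = c} = {w * of_int i..<w * of_int i + w} \<times> {w * of_int j..<w * of_int j + w}"
    unfolding c cell_bounds[OF assms] by (auto simp: mem_Times_iff)
  then show ?thesis by (simp add: convex_Times)
qed

lemma cell_coarsen:
  "cell (9 * w) p = (fst (cell w p) div 9, snd (cell w p) div 9)"
proof -
  have "\<lfloor>x / (9 * w)\<rfloor> = \<lfloor>x / w\<rfloor> div 9" for x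
    using floor_divide_real_eq_div[of 9 "x / w"] by (simp add: mult.commute)
  then show ?thesis by (simp add: cell_def)
qed

text \<open>The segment is connected and leaves the triangle, so it meets the frontier, which is the
  union of the three sides.\<close>

lemma triangle_side_crossed:
  fixes a b c u v :: point
  assumes "u \<in> convex hull {a, b, c}" "v \<notin> convex hull {a, b, c}"
  shows "\<exists>l r. (l, r) \<in> {(a, b), (b, c), (c, a)} \<and> convex hull {u, v} \<inter> convex hull {l, r} \<noteq> {}"
proof -
  have "closed_segment u v \<inter> frontier (convex hull {a, b, c}) \<noteq> {}"
    using assms by (intro connected_Int_frontier) auto
  moreover have "frontier (convex hull {a, b, c}) = closed_segment a b \<union> closed_segment b c \<union> closed_segment c a"
    by (rule frontier_of_triangle) simp
  moreover define Q where "Q l r \<longleftrightarrow> closed_segment u v \<inter> closed_segment l r \<noteq> {}" for l r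
  ultimately have "Q a b \<or> Q b c \<or> Q c a" unfolding Q_def by blast
  then have "\<exists>l r. (l, r) \<in> {(a, b), (b, c), (c, a)} \<and> Q l r" by blast
  then show ?thesis unfolding Q_def segment_convex_hull .
qed

lemma hull_halfplane:
  fixes p :: point
  assumes "p \<in> convex hull S" "\<And>s. s \<in> S \<Longrightarrow> m * fst s + n * snd s \<le> k"
  shows "m * fst p + n * snd p \<le> k"
proof -
  have "convex {p. inner (m, n) p \<le> k}" by (rule convex_halfspace_le)
  moreover have "{p. inner (m, n) p \<le> k} = {p. m * fst p + n * snd p \<le> k}"
    by (auto simp: inner_prod_def)
  ultimately have "convex hull S \<subseteq> {p. m * fst p + n * snd p \<le> k}"
    using assms(2) by (intro hull_minimal) auto
  then show ?thesis using assms(1) by auto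
qed

text \<open>The vectors lead from a point of the central cell to the corners of a triangle: one up,
  one to the lower left, one to the lower right. The bounds are what remains when all four points
  vary within their cells. No open half plane bounded by a line through the origin contains all
  three.\<close>

lemma no_common_positive_direction:
  fixes w :: real
  assumes "w > 0" "\<bar>a1\<bar> < w" "a2 > 3 * w" "b1 < - 3 * w" "- 3 * w < b2" "b2 < - w"
    "c1 > 3 * w" "- 3 * w < c2" "c2 < - w"
    and d: "d1 * a1 + d2 * a2 > 0" "d1 * b1 + d2 * b2 > 0" "d1 * c1 + d2 * c2 > 0"
  shows False
proof -
  \<comment> \<open>Directions that point right (\<open>e1 \<ge> 0\<close>): positivity on the lower
    left vector forces \<open>e2 < 0\<close> and \<open>e1 < - e2\<close>, a direction too steeply
    downward to be positive on the upper vector. Directions that point left follow by reflection,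
    with the lower right vector.\<close>
  have main: False
    if h: "\<bar>x1\<bar> < w" "y1 > 3 * w" "- 3 * w < y2" "y2 < - w" "e1 \<ge> 0"
      "e1 * x1 + e2 * y1 > 0" "- e1 * z1 + e2 * y2 > 0" "z1 > 3 * w" for x1 y1 y2 z1 e1 e2
  proof -
    have "e1 * z1 \<ge> e1 * (3 * w)" using h by (intro mult_left_mono) auto
    then have 1: "e2 * y2 > e1 * (3 * w)" using h by linarith
    then have "e2 * y2 > 0" using h(5) \<open>w > 0\<close> by (smt (verit) mult_nonneg_nonneg)
    then have neg: "e2 < 0" using h(4) \<open>w > 0\<close> by (simp add: zero_less_mult_iff)
    have "- e2 * (- y2) \<le> - e2 * (3 * w)" using h neg by (intro mult_left_mono) auto
    then have "e1 * (3 * w) < (- e2) * (3 * w)" using 1 by linarith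
    then have lt: "e1 < - e2" using \<open>w > 0\<close> by (intro mult_right_less_imp_less[of e1 "3 * w"]) auto
    have "e1 * x1 \<le> e1 * w" using h by (intro mult_left_mono) auto
    moreover have "(- e2) * y1 \<ge> (- e2) * (3 * w)" using h neg by (intro mult_left_mono) auto
    moreover have "e1 * w \<le> (- e2) * w" using lt \<open>w > 0\<close> by (intro mult_right_mono) auto
    moreover have "(- e2) * w > 0" using neg \<open>w > 0\<close> by (simp add: mult_neg_pos)
    ultimately show False using h(6) by linarith
  qed
  show False
  proof (cases "d1 \<ge> 0")
    case True
    then show False using main[of a1 a2 b2 d1 d2 "- b1"] assms by simp
  next
    case False
    then show False using main[of "- a1" a2 c2 "- d1" d2 c1] assms by simp
  qed
qed

text \<open>A point outside the triangle is strictly separated from it, and the normal of the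
  separating line is a direction positive towards all three corners.\<close>

lemma point_in_triangle:
  fixes p a b c :: point
  assumes "\<And>d1 d2. d1 * (fst a - fst p) + d2 * (snd a - snd p) > 0 \<Longrightarrow>
     d1 * (fst b - fst p) + d2 * (snd b - snd p) > 0 \<Longrightarrow>
     d1 * (fst c - fst p) + d2 * (snd c - snd p) > 0 \<Longrightarrow> False"
  shows "p \<in> convex hull {a, b, c}"
proof (rule ccontr)
  assume "p \<notin> convex hull {a, b, c}"
  moreover have "closed (convex hull {a, b, c})"
    by (intro compact_imp_closed compact_convex_hull finite_imp_compact) auto
  ultimately obtain d k where d: "inner d p < k" "\<forall>x\<in>convex hull {a, b, c}. k < inner d x"
    using separating_hyperplane_closed_point[of "convex hull {a, b, c}" p] by auto
  have *: "inner d p < inner d x" if "x \<in> {a, b, c}" for x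
    using d hull_inc[OF that, of convex] by force
  show False
    using *[of a] *[of b] *[of c] assms[of "fst d" "snd d"]
    by (simp add: inner_prod_def algebra_simps)
qed

text \<open>The point \<open>(X, Y)\<close> below is the lower left corner of the central cell of the grid.\<close>

lemma tree_edge_crosses_hexagram:
  assumes w: "w > 0" and T: "spanning_tree P E"
    and full: "\<And>s t. s \<in> {0..8} \<Longrightarrow> t \<in> {0..8} \<Longrightarrow> \<exists>q\<in>P. cell w q = (9 * i + s, 9 * j + t)"
  shows "\<exists>u v l r. {u, v} \<in> E \<and> l \<in> P \<and> r \<in> P \<and> l \<noteq> r \<and> u \<notin> {l, r} \<and> v \<notin> {l, r} \<and>
    cell (9 * w) u = (i, j) \<and> cell (9 * w) l = (i, j) \<and> cell (9 * w) r = (i, j) \<and>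
    convex hull {u, v} \<inter> convex hull {l, r} \<noteq> {}"
proof -
  define X Y where "X = w * of_int (9 * i + 4)" and "Y = w * of_int (9 * j + 4)"
  \<comment> \<open>Offsets are counted from the central cell, whose index in the grid is 4 in both
    coordinates.\<close>
  have pt: "\<exists>q\<in>P. cell (9 * w) q = (i, j) \<and> X + w * of_int s \<le> fst q \<and> fst q < X + w * of_int s + w
      \<and> Y + w * of_int t \<le> snd q \<and> snd q < Y + w * of_int t + w"
    if st: "s \<in> {-4..4}" "t \<in> {-4..4}" for s t
  proof -
    obtain q where q: "q \<in> P" "cell w q = (9 * i + (4 + s), 9 * j + (4 + t))"
      using full[of "4 + s" "4 + t"] st by auto
    have "(9 * i + (4 + s)) div 9 = i" "(9 * j + (4 + t)) div 9 = j" using st by auto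
    then have "cell (9 * w) q = (i, j)" unfolding cell_coarsen q(2) by simp
    then show ?thesis using q cell_bounds[OF w] unfolding X_def Y_def
      by (auto simp: algebra_simps intro!: bexI[of _ q])
  qed
  \<comment> \<open>The triangle \<open>a\<close>, \<open>b\<close>, \<open>c\<close> points up. The
    triangle \<open>a'\<close>, \<open>b'\<close>, \<open>c'\<close> points down and takes its cells
    from the mirrored rows; \<open>p\<close> is in the central cell.\<close>
  obtain a where a: "a \<in> P" "cell (9 * w) a = (i, j)"
      "X \<le> fst a" "fst a < X + w" "Y + 4 * w \<le> snd a" "snd a < Y + 5 * w"
    using pt[of 0 4] by auto
  obtain b where b: "b \<in> P" "cell (9 * w) b = (i, j)"
      "X - 4 * w \<le> fst b" "fst b < X - 3 * w" "Y - 2 * w \<le> snd b" "snd b < Y - w"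
    using pt[of "-4" "-2"] by auto
  obtain c where c: "c \<in> P" "cell (9 * w) c = (i, j)"
      "X + 4 * w \<le> fst c" "fst c < X + 5 * w" "Y - 2 * w \<le> snd c" "snd c < Y - w"
    using pt[of 4 "-2"] by auto
  obtain a' where a': "a' \<in> P" "cell (9 * w) a' = (i, j)"
      "X \<le> fst a'" "fst a' < X + w" "Y - 4 * w \<le> snd a'" "snd a' < Y - 3 * w"
    using pt[of 0 "-4"] by auto
  obtain b' where b': "b' \<in> P" "cell (9 * w) b' = (i, j)"
      "X - 4 * w \<le> fst b'" "fst b' < X - 3 * w" "Y + 2 * w \<le> snd b'" "snd b' < Y + 3 * w"
    using pt[of "-4" 2] by auto
  obtain c' where c': "c' \<in> P" "cell (9 * w) c' = (i, j)"
      "X + 4 * w \<le> fst c'" "fst c' < X + 5 * w" "Y + 2 * w \<le> snd c'" "snd c' < Y + 3 * w"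
    using pt[of 4 2] by auto
  obtain p where p: "p \<in> P" "X \<le> fst p" "fst p < X + w" "Y \<le> snd p" "snd p < Y + w"
    using pt[of 0 0] by auto
  have distinct: "a \<noteq> b" "b \<noteq> c" "c \<noteq> a" "a' \<noteq> b'" "b' \<noteq> c'" "c' \<noteq> a'"
    using a b c a' b' c' w by auto
  have pD: "p \<in> convex hull {a, b, c}"
  proof (rule point_in_triangle)
    fix d1 d2 :: real
    assume "d1 * (fst a - fst p) + d2 * (snd a - snd p) > 0"
      "d1 * (fst b - fst p) + d2 * (snd b - snd p) > 0"
      "d1 * (fst c - fst p) + d2 * (snd c - snd p) > 0"
    then show False using a b c p
      by (intro no_common_positive_direction[OF w, of "fst a - fst p" "snd a - snd p"
          "fst b - fst p" "snd b - snd p" "fst c - fst p" "snd c - snd p" d1 d2]) auto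
  qed
  have pD': "p \<in> convex hull {a', b', c'}"
  proof (rule point_in_triangle)
    fix d1 d2 :: real
    assume "d1 * (fst a' - fst p) + d2 * (snd a' - snd p) > 0"
      "d1 * (fst b' - fst p) + d2 * (snd b' - snd p) > 0"
      "d1 * (fst c' - fst p) + d2 * (snd c' - snd p) > 0"
    then show False using a' b' c' p
      \<comment> \<open>The triangle pointing down is reflected: second coordinates and
        \<open>d2\<close> change sign.\<close>
      by (intro no_common_positive_direction[OF w, of "fst a' - fst p" "snd p - snd a'"
          "fst b' - fst p" "snd p - snd b'" "fst c' - fst p" "snd p - snd c'" d1 "- d2"])
        (auto simp: algebra_simps)
  qed
  \<comment> \<open>For each of the six tips, a half plane contains the other triangle and misses
    the tip. For the oblique ones, slope and constant are those of the line through the outer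
    corners of the two cells next to that side.\<close>
  have "a \<notin> convex hull {a', b', c'}"
  proof
    assume "a \<in> convex hull {a', b', c'}"
    then have "0 * fst a + 1 * snd a \<le> Y + 3 * w"
      by (rule hull_halfplane) (use a' b' c' w in auto)
    then show False using a by simp
  qed
  moreover have "b \<notin> convex hull {a', b', c'}"
  proof
    assume "b \<in> convex hull {a', b', c'}"
    then have "(- 3/2) * fst b + (- 1) * snd b \<le> - 3/2 * X - Y + 4 * w"
      by (rule hull_halfplane) (use a' b' c' w in auto)
    then show False using b by simp
  qed
  moreover have "c \<notin> convex hull {a', b', c'}"
  proof
    assume "c \<in> convex hull {a', b', c'}"
    then have "3/2 * fst c + (- 1) * snd c \<le> 3/2 * X - Y + 11/2 * w"
      by (rule hull_halfplane) (use a' b' c' w in auto)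
    then show False using c by simp
  qed
  ultimately have out: "a \<notin> convex hull {a', b', c'}" "b \<notin> convex hull {a', b', c'}" "c \<notin> convex hull {a', b', c'}" .
  have "a' \<notin> convex hull {a, b, c}"
  proof
    assume "a' \<in> convex hull {a, b, c}"
    then have "0 * fst a' + (- 1) * snd a' \<le> - Y + 2 * w"
      by (rule hull_halfplane) (use a b c w in auto)
    then show False using a' by simp
  qed
  moreover have "b' \<notin> convex hull {a, b, c}"
  proof
    assume "b' \<in> convex hull {a, b, c}"
    then have "(- 3/2) * fst b' + 1 * snd b' \<le> - 3/2 * X + Y + 5 * w"
      by (rule hull_halfplane) (use a b c w in auto)
    then show False using b' by simp
  qed
  moreover have "c' \<notin> convex hull {a, b, c}"
  proof
    assume "c' \<in> convex hull {a, b, c}"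
    then have "3/2 * fst c' + 1 * snd c' \<le> 3/2 * X + Y + 13/2 * w"
      by (rule hull_halfplane) (use a b c w in auto)
    then show False using c' by simp
  qed
  ultimately have out': "a' \<notin> convex hull {a, b, c}" "b' \<notin> convex hull {a, b, c}" "c' \<notin> convex hull {a, b, c}" .
  \<comment> \<open>\<open>p\<close> lies in \<open>H\<close> and \<open>a\<close> does not, so the
    tree has an edge from some \<open>u\<close> in \<open>H\<close> to some \<open>v\<close> outside
    one of the triangles. Only \<open>u\<close> is confined to the coarse cell; \<open>v\<close> may
    be far away.\<close>
  define H where "H = convex hull {a, b, c} \<inter> convex hull {a', b', c'}"
  have "(p, a) \<in> (adj E)\<^sup>*" using T p a by (simp add: spanning_tree_def)
  then obtain u v where uv: "u \<in> H" "v \<notin> H" "{u, v} \<in> E"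
    by (rule reach_leaves_set[where A = H]) (auto simp: H_def pD pD' out)
  have "convex hull {a, b, c} \<subseteq> {q. cell (9 * w) q = (i, j)}"
    using a b c w by (intro hull_minimal convex_cell) auto
  then have cu: "cell (9 * w) u = (i, j)" using uv by (auto simp: H_def)
  \<comment> \<open>Every corner lies outside the other triangle, hence outside
    \<open>H\<close>.\<close>
  have u: "u \<notin> {a, b, c}" "u \<notin> {a', b', c'}" using uv out out' by (auto simp: H_def)
  show ?thesis
  proof (cases "v \<in> convex hull {a, b, c}")
    case False
    then have v: "v \<notin> {a, b, c}" using hull_inc[of v "{a, b, c}" convex] by blast
    obtain l r where lr: "(l, r) \<in> {(a, b), (b, c), (c, a)}"
        "convex hull {u, v} \<inter> convex hull {l, r} \<noteq> {}"
      using triangle_side_crossed[of u a b c v] False uv(1) unfolding H_def by blast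
    have "l \<in> P \<and> r \<in> P \<and> l \<noteq> r \<and> cell (9 * w) l = (i, j) \<and> cell (9 * w) r = (i, j) \<and>
        l \<in> {a, b, c} \<and> r \<in> {a, b, c}"
      using lr(1) a(1,2) b(1,2) c(1,2) distinct by (auto simp del: split_paired_All split_paired_Ex)
    moreover from this have "u \<notin> {l, r}" "v \<notin> {l, r}" using u(1) v by blast+
    ultimately show ?thesis using uv(3) cu lr(2) by blast
  next
    case True
    then have nin: "v \<notin> convex hull {a', b', c'}" using uv by (auto simp: H_def)
    then have v: "v \<notin> {a', b', c'}" using hull_inc[of v "{a', b', c'}" convex] by blast
    obtain l r where lr: "(l, r) \<in> {(a', b'), (b', c'), (c', a')}"
        "convex hull {u, v} \<inter> convex hull {l, r} \<noteq> {}"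
      using triangle_side_crossed[of u a' b' c' v] nin uv(1) unfolding H_def by blast
    have "l \<in> P \<and> r \<in> P \<and> l \<noteq> r \<and> cell (9 * w) l = (i, j) \<and> cell (9 * w) r = (i, j) \<and>
        l \<in> {a', b', c'} \<and> r \<in> {a', b', c'}"
      using lr(1) a'(1,2) b'(1,2) c'(1,2) distinct by (auto simp del: split_paired_All split_paired_Ex)
    moreover from this have "u \<notin> {l, r}" "v \<notin> {l, r}" using u(2) v by blast+
    ultimately show ?thesis using uv(3) cu lr(2) by blast
  qed
qed

subsection \<open>Dense cells\<close>

lemma card_coarse_cell_le:
  assumes "finite P"
  shows "card {p \<in> P. cell (9 * w) p = (i, j)} \<le>
    (\<Sum>c\<in>{9 * i..9 * i + 8} \<times> {9 * j..9 * j + 8}. card {p \<in> P. cell w p = c})"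
proof -
  have "{p \<in> P. cell (9 * w) p = (i, j)} \<subseteq>
      (\<Union>c\<in>{9 * i..9 * i + 8} \<times> {9 * j..9 * j + 8}. {p \<in> P. cell w p = c})"
    by (auto simp: cell_coarsen mem_Times_iff)
  then have "card {p \<in> P. cell (9 * w) p = (i, j)} \<le>
      card (\<Union>c\<in>{9 * i..9 * i + 8} \<times> {9 * j..9 * j + 8}. {p \<in> P. cell w p = c})"
    using assms by (intro card_mono) auto
  also have "\<dots> \<le> (\<Sum>c\<in>{9 * i..9 * i + 8} \<times> {9 * j..9 * j + 8}. card {p \<in> P. cell w p = c})"
    by (rule card_UN_le) simp
  finally show ?thesis .
qed

lemma card_cell_le:
  assumes "finite P" "inj_on (cell h) P"
  shows "card {p \<in> P. cell (9 ^ k * h) p = c} \<le> 81 ^ k"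
proof (induction k arbitrary: c)
  case 0
  have "\<forall>p\<in>{p \<in> P. cell h p = c}. \<forall>q\<in>{p \<in> P. cell h p = c}. p = q"
    using assms(2) by (auto simp del: split_paired_All simp: inj_on_def)
  then show ?case using assms(1) by (simp add: card_le_Suc0_iff_eq)
next
  case (Suc k)
  obtain i j where c: "c = (i, j)" by fastforce
  have "card {p \<in> P. cell (9 * (9 ^ k * h)) p = (i, j)} \<le>
      (\<Sum>c\<in>{9 * i..9 * i + 8} \<times> {9 * j..9 * j + 8}. 81 ^ k)"
    using card_coarse_cell_le[OF assms(1), of "9 ^ k * h" i j] sum_mono[OF Suc]
    by (rule order_trans)
  then show ?case by (simp add: c mult.assoc card_cartesian_product)
qed

text \<open>Descent through the scales: if one of the 81 subcells is empty, the other 80 cannot all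
  have at most \<open>80 ^ k\<close> points, so one of them is dense at the next level. The descent
  stops before level 0, where a cell has at most \<open>80 ^ 0 = 1\<close> point.\<close>

lemma dense_cell_contains_full_grid:
  assumes "finite P" "inj_on (cell h) P" "card {p \<in> P. cell (9 ^ k * h) p = c} > 80 ^ k"
  shows "\<exists>m i j. (\<forall>s\<in>{0..8}. \<forall>t\<in>{0..8}. \<exists>q\<in>P. cell (9 ^ m * h) q = (9 * i + s, 9 * j + t)) \<and>
    (\<forall>q. cell (9 * (9 ^ m * h)) q = (i, j) \<longrightarrow> cell (9 ^ k * h) q = c)"
  using assms(3)
proof (induction k arbitrary: c)
  case 0
  then show ?case using card_cell_le[OF assms(1,2), of 0 c] by simp
next
  case (Suc k)
  obtain i j where c: "c = (i, j)" by fastforce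
  let ?w = "9 ^ k * h"
  let ?C = "{9 * i..9 * i + 8} \<times> {9 * j..9 * j + 8}"
  have pow: "9 ^ Suc k * h = 9 * ?w" by simp
  show ?case
  proof (cases "\<forall>s\<in>{0..8}. \<forall>t\<in>{0..8}. \<exists>q\<in>P. cell ?w q = (9 * i + s, 9 * j + t)")
    case True
    then show ?thesis unfolding c pow by blast
  next
    case False
    then obtain s t where st: "s \<in> {0..8}" "t \<in> {0..8}"
        and none: "\<forall>q\<in>P. cell ?w q \<noteq> (9 * i + s, 9 * j + t)" by blast
    let ?e = "(9 * i + s, 9 * j + t)"
    have e: "?e \<in> ?C" using st by simp
    have "card {p \<in> P. cell ?w p = ?e} = 0" using none by (simp only: card_eq_0_iff) blast
    then have "card {p \<in> P. cell (9 * ?w) p = (i, j)} \<le> (\<Sum>c\<in>?C - {?e}. card {p \<in> P. cell ?w p = c})"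
      using card_coarse_cell_le[OF assms(1), of ?w i j] e by (simp add: sum.remove[of ?C ?e])
    then have lt: "80 ^ Suc k < (\<Sum>c\<in>?C - {?e}. card {p \<in> P. cell ?w p = c})"
      using Suc.prems unfolding c pow by linarith
    have c80: "card (?C - {?e}) = 80" using e by (simp add: card_cartesian_product)
    have "\<exists>d\<in>?C - {?e}. card {p \<in> P. cell ?w p = d} > 80 ^ k"
    proof (rule ccontr)
      assume "\<not> ?thesis"
      then have "(\<Sum>c\<in>?C - {?e}. card {p \<in> P. cell ?w p = c}) \<le> (\<Sum>c\<in>?C - {?e}. 80 ^ k)"
        by (intro sum_mono) (simp only: not_less bex_simps ball_simps)
      also have "\<dots> = 80 ^ Suc k" using c80 by (simp only: sum_constant of_nat_id power_Suc)
      finally show False using lt by linarith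
    qed
    then obtain d where d: "d \<in> ?C" "card {p \<in> P. cell ?w p = d} > 80 ^ k" by blast
    obtain m i' j' where m:
        "\<forall>s\<in>{0..8}. \<forall>t\<in>{0..8}. \<exists>q\<in>P. cell (9 ^ m * h) q = (9 * i' + s, 9 * j' + t)"
        "\<forall>q. cell (9 * (9 ^ m * h)) q = (i', j') \<longrightarrow> cell ?w q = d"
      using Suc.IH[OF d(2)] by blast
    have "cell (9 * ?w) q = c" if "cell ?w q = d" for q
      using d(1) by (auto simp: cell_coarsen that c mem_Times_iff)
    then show ?thesis using m unfolding pow by blast
  qed
qed

lemma dense_cell_crossed:
  assumes "finite P" "inj_on (cell h) P" "h > 0" "spanning_tree P E"
    and "card {p \<in> P. cell (9 ^ k * h) p = c} > 80 ^ k"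
  shows "\<exists>u v l r. {u, v} \<in> E \<and> l \<in> P \<and> r \<in> P \<and> l \<noteq> r \<and> u \<notin> {l, r} \<and> v \<notin> {l, r} \<and>
    cell (9 ^ k * h) u = c \<and> cell (9 ^ k * h) l = c \<and> cell (9 ^ k * h) r = c \<and>
    convex hull {u, v} \<inter> convex hull {l, r} \<noteq> {}"
proof -
  obtain m i j where m:
      "\<forall>s\<in>{0..8}. \<forall>t\<in>{0..8}. \<exists>q\<in>P. cell (9 ^ m * h) q = (9 * i + s, 9 * j + t)"
      "\<forall>q. cell (9 * (9 ^ m * h)) q = (i, j) \<longrightarrow> cell (9 ^ k * h) q = c"
    using dense_cell_contains_full_grid[OF assms(1,2,5)] by blast
  have "9 ^ m * h > 0" using \<open>h > 0\<close> by simp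
  from tree_edge_crosses_hexagram[OF this assms(4), of i j] m show ?thesis by blast
qed

text \<open>In the graph with an arrow from each \<open>x\<close> to \<open>g x\<close>, the average
  in-degree within \<open>I\<close> is at most 1. Hence some \<open>i\<close> has in-degree at most
  1; it is kept, and the at most three elements consisting of \<open>i\<close>, its image and its
  preimage are removed before recursing.\<close>

lemma independent_third:
  assumes "finite I"
  shows "\<exists>J\<subseteq>I. card I \<le> 3 * card J \<and> (\<forall>i\<in>J. g i \<in> J \<longrightarrow> g i = i)"
  using assms
proof (induction I rule: finite_psubset_induct)
  case (psubset I)
  show ?case
  proof (cases "I = {}")
    case False
    have "\<exists>i\<in>I. card {x \<in> I. g x = i} \<le> 1"
    proof (rule ccontr)
      assume "\<not> ?thesis"
      then have "2 * card I \<le> (\<Sum>i\<in>I. card {x \<in> I. g x = i})"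
        using sum_bounded_below[of I 2 "\<lambda>i. card {x \<in> I. g x = i}"] by force
      also have "\<dots> = card (\<Union>i\<in>I. {x \<in> I. g x = i})"
        using psubset(1) by (intro card_UN_disjoint[symmetric]) auto
      also have "\<dots> \<le> card I" using psubset(1) by (intro card_mono) auto
      finally show False using False psubset(1) by (simp add: card_gt_0_iff)
    qed
    then obtain i where i: "i \<in> I" "card {x \<in> I. g x = i} \<le> 1" by blast
    define N where "N = insert i (insert (g i) {x \<in> I. g x = i})"
    have "finite N" using psubset(1) by (simp add: N_def)
    have "card N \<le> 3"
    proof -
      have "card N \<le> Suc (card (insert (g i) {x \<in> I. g x = i}))"
        unfolding N_def by (rule card_insert_le_m1[where n = "Suc _", simplified]) simp_all
      also have "card (insert (g i) {x \<in> I. g x = i}) \<le> Suc (card {x \<in> I. g x = i})"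
        by (rule card_insert_le_m1[where n = "Suc _", simplified]) simp_all
      finally show ?thesis using i(2) by simp
    qed
    have "I - N \<subset> I" using i(1) by (auto simp: N_def)
    from psubset(2)[OF this] obtain J where J: "J \<subseteq> I - N" "card (I - N) \<le> 3 * card J"
        "\<forall>i\<in>J. g i \<in> J \<longrightarrow> g i = i" by blast
    have finJ: "finite J" "i \<notin> J" using J(1) psubset(1) finite_subset by (auto simp: N_def)
    have "card I \<le> card (I - N) + card N"
      using \<open>finite N\<close> psubset(1) by (metis card_Un_le card_mono finite_Diff finite_UnI le_trans Un_Diff_cancel2 Un_upper1)
    then have "card I \<le> 3 * card (insert i J)" using J(2) finJ \<open>card N \<le> 3\<close> by simp
    moreover have "\<forall>x\<in>insert i J. g x \<in> insert i J \<longrightarrow> g x = x"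
      using J(1,3) by (auto simp: N_def)
    moreover have "insert i J \<subseteq> I" using i J by auto
    ultimately show ?thesis by blast
  qed auto
qed

text \<open>\<open>H\<close> is a largest of the nine classes of cells modulo 3 in both
  coordinates.\<close>

lemma sparse_subset_of_grid:
  fixes G :: "(int \<times> int) set"
  assumes "finite G"
  shows "\<exists>H\<subseteq>G. card G \<le> 9 * card H \<and>
    (\<forall>c\<in>H. \<forall>d\<in>H. c \<noteq> d \<longrightarrow> \<bar>fst c - fst d\<bar> \<ge> 3 \<or> \<bar>snd c - snd d\<bar> \<ge> 3)"
proof -
  let ?K = "{0..2::int} \<times> {0..2::int}"
  let ?F = "\<lambda>k. {c \<in> G. (fst c mod 3, snd c mod 3) = k}"
  have "card G \<le> card (\<Union>k\<in>?K. ?F k)"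
    using assms by (intro card_mono) (auto simp: mem_Times_iff)
  also have "\<dots> \<le> (\<Sum>k\<in>?K. card (?F k))" by (rule card_UN_le) simp
  finally have le: "card G \<le> (\<Sum>k\<in>?K. card (?F k))" .
  have "\<exists>k\<in>?K. card G \<le> 9 * card (?F k)"
  proof (rule ccontr)
    assume "\<not> ?thesis"
    then have "(\<Sum>k\<in>?K. 9 * card (?F k)) < (\<Sum>k\<in>?K. card G)"
      by (intro sum_strict_mono) (auto simp: not_le)
    then show False using le by (simp add: card_cartesian_product sum_distrib_left[symmetric])
  qed
  then obtain k where k: "card G \<le> 9 * card (?F k)" by blast
  have far: "\<bar>x - y\<bar> \<ge> 3" if "x mod 3 = y mod 3" "x \<noteq> y" for x y :: int
    using that by presburger
  have "\<forall>c\<in>?F k. \<forall>d\<in>?F k. c \<noteq> d \<longrightarrow> \<bar>fst c - fst d\<bar> \<ge> 3 \<or> \<bar>snd c - snd d\<bar> \<ge> 3"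
    using far by (auto simp: prod_eq_iff)
  then show ?thesis using k by (intro exI[of _ "?F k"]) auto
qed

section \<open>Distances within and between cells\<close>

lemma dist_le_same_cell:
  assumes "w > 0" "cell w p = c" "cell w q = c"
  shows "dist p q \<le> 2 * w"
proof -
  obtain i j where c: "c = (i, j)" by fastforce
  have "\<bar>fst p - fst q\<bar> \<le> w" "\<bar>snd p - snd q\<bar> \<le> w"
    using assms unfolding c cell_bounds[OF assms(1)] by linarith+
  moreover have "dist p q \<le> \<bar>fst p - fst q\<bar> + \<bar>snd p - snd q\<bar>"
    unfolding dist_prod_def dist_real_def by (rule sqrt_sum_squares_le_sum_abs[THEN order_trans]) simp
  ultimately show ?thesis by linarith
qed

text \<open>An index difference of 3 leaves two whole cells in between. This beats the bound of
  \<open>dist_le_same_cell\<close>, which makes \<open>r\<close> the blue point nearest to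
  \<open>l\<close>.\<close>

lemma dist_gt_far_cells:
  assumes "w > 0" "\<bar>fst (cell w p) - fst (cell w q)\<bar> \<ge> 3 \<or> \<bar>snd (cell w p) - snd (cell w q)\<bar> \<ge> 3"
  shows "dist p q > 2 * w"
proof -
  have floor: "\<bar>x - y\<bar> > 2 * w" if "\<bar>\<lfloor>x / w\<rfloor> - \<lfloor>y / w\<rfloor>\<bar> \<ge> 3" for x y
  proof -
    have "\<bar>x / w - y / w\<bar> > 2" using that by linarith
    then have "\<bar>x - y\<bar> / w > 2" using assms(1) by (simp flip: diff_divide_distrib)
    then show ?thesis using assms(1) by (simp add: field_simps)
  qed
  have "\<bar>fst p - fst q\<bar> > 2 * w \<or> \<bar>snd p - snd q\<bar> > 2 * w"
    using assms(2) floor by (auto simp: cell_def)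
  then show ?thesis
    using dist_fst_le[of p q] dist_snd_le[of p q] by (auto simp: dist_real_def)
qed

subsection \<open>Colouring\<close>

text \<open>The factor 27 is the cost of two selections: a ninth of the cells are pairwise far
  apart, and among these a third are such that no \<open>v c\<close> lies in another selected cell.
  Each remaining cell yields its own crossing.\<close>

lemma card_crossed_cells_le_cr:
  assumes gen: "generic P" and w: "w > 0" and G: "finite G"
    and crossed: "\<And>c. c \<in> G \<Longrightarrow> \<exists>u v l r. {u, v} \<in> MST P \<and> l \<in> P \<and> r \<in> P \<and> l \<noteq> r \<and>
      u \<notin> {l, r} \<and> v \<notin> {l, r} \<and> cell w u = c \<and> cell w l = c \<and> cell w r = c \<and>
      convex hull {u, v} \<inter> convex hull {l, r} \<noteq> {}"
  shows "card G \<le> 27 * cr P"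
proof -
  define Q where "Q c u v l r \<longleftrightarrow> {u, v} \<in> MST P \<and> l \<in> P \<and> r \<in> P \<and> l \<noteq> r \<and>
      u \<notin> {l, r} \<and> v \<notin> {l, r} \<and> cell w u = c \<and> cell w l = c \<and> cell w r = c \<and>
      convex hull {u, v} \<inter> convex hull {l, r} \<noteq> {}" for c u v l r
  have "\<forall>c\<in>G. \<exists>u v l r. Q c u v l r" using crossed unfolding Q_def by blast
  then obtain u v l r where uvlr: "\<forall>c\<in>G. Q c (u c) (v c) (l c) (r c)"
    unfolding bchoice_iff by blast
  obtain H where H: "H \<subseteq> G" "card G \<le> 9 * card H"
    and far: "\<forall>c\<in>H. \<forall>d\<in>H. c \<noteq> d \<longrightarrow> \<bar>fst c - fst d\<bar> \<ge> 3 \<or> \<bar>snd c - snd d\<bar> \<ge> 3"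
    using sparse_subset_of_grid[OF G] by blast
  \<comment> \<open>The edge from \<open>u c\<close> may be long, and then \<open>v c\<close> may be a blue point chosen in another cell.\<close>
  obtain J where J: "J \<subseteq> H" "card H \<le> 3 * card J"
    and indep: "\<forall>c\<in>J. cell w (v c) \<in> J \<longrightarrow> cell w (v c) = c"
    using independent_third[OF finite_subset[OF H(1) G], of "\<lambda>c. cell w (v c)"] by blast
  have Q: "Q c (u c) (v c) (l c) (r c)" if "c \<in> J" for c using uvlr that H J by blast
  have cells: "cell w (u c) = c" "cell w (l c) = c" "cell w (r c) = c" if "c \<in> J" for c
    using Q[OF that] by (simp_all add: Q_def)
  have lr: "l c \<in> P" "r c \<in> P" "l c \<noteq> r c" if "c \<in> J" for c
    using Q[OF that] by (simp_all add: Q_def)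
  have cross: "convex hull {u c, v c} \<inter> convex hull {l c, r c} \<noteq> {}" if "c \<in> J" for c
    using Q[OF that] unfolding Q_def by meson
  define B where "B = (\<Union>c\<in>J. {l c, r c})"
  have B: "B \<subseteq> P" using lr by (auto simp: B_def)
  have B_cases: "\<exists>d\<in>J. x \<in> {l d, r d} \<and> cell w x = d" if "x \<in> B" for x
    using that cells unfolding B_def by blast
  \<comment> \<open>The only other blue point in the cell \<open>c\<close> is \<open>r c\<close>;
    all remaining blue points lie in far cells.\<close>
  have blue: "{l c, r c} \<in> MST B" if c: "c \<in> J" for c
  proof (rule nearest_neighbour_in_MST[OF gen B])
    show "l c \<in> B" "r c \<in> B" using c by (auto simp: B_def)
    show "dist (l c) (r c) \<le> dist (l c) x" if x: "x \<in> B" "x \<noteq> l c" for x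
    proof -
      obtain d where d: "d \<in> J" "x \<in> {l d, r d}" "cell w x = d" using B_cases x by blast
      show ?thesis
      proof (cases "c = d")
        case True
        then show ?thesis using d x by auto
      next
        case False
        have "dist (l c) (r c) \<le> 2 * w" using cells[OF c] by (intro dist_le_same_cell[OF w])
        also have "\<dots> < dist (l c) x"
          using far J(1) c d(1) False cells(2)[OF c] d(3) by (intro dist_gt_far_cells[OF w]) auto
        finally show ?thesis by simp
      qed
    qed
  qed (rule lr[OF c])
  \<comment> \<open>A blue point in the cell \<open>c\<close> is \<open>l c\<close> or
    \<open>r c\<close>, which \<open>u c\<close> is not. If \<open>v c\<close> were blue, its cell
    would be in \<open>J\<close>, hence equal to \<open>c\<close> by \<open>indep\<close>, and the
    same argument applies.\<close>
  have red: "{u c, v c} \<in> MST (P - B)" if c: "c \<in> J" for c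
  proof (rule MST_restrict[OF gen])
    have e: "{u c, v c} \<in> MST P" "u c \<notin> {l c, r c}" "v c \<notin> {l c, r c}"
      using Q[OF c] by (simp_all add: Q_def)
    have "spanning_tree P (MST P)" using generic_MST(1)[OF gen subset_refl] by (simp add: is_MST_def)
    from spanning_tree_edge[OF this e(1)] have "u c \<in> P" "v c \<in> P" by (auto simp: doubleton_eq_iff)
    moreover have "u c \<notin> B"
    proof
      assume "u c \<in> B"
      then obtain d where "u c \<in> {l d, r d}" "cell w (u c) = d" using B_cases by blast
      then show False using cells(1)[OF c] e(2) by simp
    qed
    moreover have "v c \<notin> B"
    proof
      assume "v c \<in> B"
      then obtain d where d: "d \<in> J" "v c \<in> {l d, r d}" "cell w (v c) = d" using B_cases by blast
      then have "d = c" using indep c by auto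
      then show False using d(2) e(3) by simp
    qed
    ultimately show "u c \<in> P - B" "v c \<in> P - B" by auto
    show "{u c, v c} \<in> MST P" by fact
  qed auto
  let ?X = "{(e, f). e \<in> MST (P - B) \<and> f \<in> MST B \<and> convex hull e \<inter> convex hull f \<noteq> {}}"
  have fin: "finite (MST X)" if "X \<subseteq> P" for X
    using generic_MST(1,3)[OF gen that] spanning_tree_finite unfolding is_MST_def by blast
  \<comment> \<open>The blue edge determines \<open>c\<close>, as both its ends lie in that
    cell.\<close>
  have "inj_on (\<lambda>c. ({u c, v c}, {l c, r c})) J"
  proof (rule inj_onI)
    fix c d
    assume c: "c \<in> J" and d: "d \<in> J" and eq: "({u c, v c}, {l c, r c}) = ({u d, v d}, {l d, r d})"
    then have "l c \<in> {l d, r d}" by blast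
    then have "cell w (l c) = d" using cells(2,3)[OF d] by (metis empty_iff insert_iff)
    then show "c = d" using cells(2)[OF c] by simp
  qed
  moreover have "(\<lambda>c. ({u c, v c}, {l c, r c})) ` J \<subseteq> ?X"
  proof (rule image_subsetI)
    fix c
    assume c: "c \<in> J"
    have "convex hull {u c, v c} \<inter> convex hull {l c, r c} \<noteq> {}" by (rule cross[OF c])
    then show "({u c, v c}, {l c, r c}) \<in> ?X"
      using red[OF c] blue[OF c] by (simp only: mem_Collect_eq case_prod_conv simp_thms)
  qed
  moreover have "finite ?X"
    by (rule finite_subset[of _ "MST (P - B) \<times> MST B"]) (use fin[of "P - B"] fin[OF B] in auto)
  ultimately have "card J \<le> cr2 (P - B) B"
    unfolding cr2_def by (rule card_inj_on_le)
  moreover have "P - (P - B) = B" using B by blast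
  moreover have "cr2 (P - B) (P - (P - B)) \<le> cr P"
  proof -
    have "{cr2 R (P - R) | R. R \<subseteq> P} = (\<lambda>R. cr2 R (P - R)) ` Pow P" by auto
    then have "finite {cr2 R (P - R) | R. R \<subseteq> P}" using gen by (simp add: generic_def)
    then show ?thesis unfolding cr_def by (intro Max_ge) auto
  qed
  ultimately show ?thesis using H(2) J(2) by simp
qed

section \<open>Counting cells and the final estimate\<close>

lemma alpha_dense_min_dist:
  assumes "alpha_dense \<alpha> P"
  shows "min_dist P > 0" and "p \<in> P \<Longrightarrow> q \<in> P \<Longrightarrow> p \<noteq> q \<Longrightarrow> min_dist P \<le> dist p q"
proof -
  let ?D = "{dist p q | p q. p \<in> P \<and> q \<in> P \<and> p \<noteq> q}"
  have P: "finite P" "card P \<ge> 2" using assms by (auto simp: alpha_dense_def)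
  have "?D \<subseteq> (\<lambda>(p, q). dist p q) ` (P \<times> P)" by auto
  then have fin: "finite ?D" using P finite_subset by blast
  obtain a b where "a \<in> P" "b \<in> P" "a \<noteq> b"
    using P by (metis card_le_Suc0_iff_eq not_less_eq_eq numeral_2_eq_2)
  then have "?D \<noteq> {}" by blast
  then have "min_dist P \<in> ?D" unfolding min_dist_def using fin by (rule Min_in[rotated])
  then show "min_dist P > 0" by (auto simp del: split_paired_All split_paired_Ex)
  show "min_dist P \<le> dist p q" if "p \<in> P" "q \<in> P" "p \<noteq> q"
    unfolding min_dist_def using fin that by (intro Min_le) blast+
qed

lemma card_cells_le:
  assumes "w > 0" "t \<ge> 3" "\<And>p q. p \<in> P \<Longrightarrow> q \<in> P \<Longrightarrow> dist p q \<le> t * w"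
  shows "real (card (cell w ` P)) \<le> 9 * t\<^sup>2"
proof (cases "P = {}")
  case False
  then obtain p0 where p0: "p0 \<in> P" by blast
  obtain i0 j0 where c0: "cell w p0 = (i0, j0)" by fastforce
  \<comment> \<open>Rounding adds at most 1 to an index difference. The cells then lie in a square
    of \<open>2 * m + 1\<close> by \<open>2 * m + 1\<close> indices, and
    \<open>2 * (t + 1) + 1 \<le> 3 * t\<close> because \<open>t \<ge> 3\<close>.\<close>
  define m where "m = \<lfloor>t + 1\<rfloor>"
  have floor: "\<bar>\<lfloor>x / w\<rfloor> - \<lfloor>y / w\<rfloor>\<bar> \<le> m" if "\<bar>x - y\<bar> \<le> t * w" for x y
  proof -
    have "\<bar>x / w - y / w\<bar> \<le> t"
      using that assms(1) by (simp add: field_simps flip: diff_divide_distrib)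
    then have "of_int \<bar>\<lfloor>x / w\<rfloor> - \<lfloor>y / w\<rfloor>\<bar> \<le> t + 1" by linarith
    then show ?thesis unfolding m_def le_floor_iff .
  qed
  have "cell w ` P \<subseteq> {i0 - m..i0 + m} \<times> {j0 - m..j0 + m}"
  proof
    fix c assume "c \<in> cell w ` P"
    then obtain p where p: "p \<in> P" "c = cell w p" by blast
    have "\<bar>fst p - fst p0\<bar> \<le> t * w" "\<bar>snd p - snd p0\<bar> \<le> t * w"
      using assms(3)[OF p(1) p0] dist_fst_le[of p p0] dist_snd_le[of p p0] by (auto simp: dist_real_def)
    then show "c \<in> {i0 - m..i0 + m} \<times> {j0 - m..j0 + m}"
      using floor[of "fst p" "fst p0"] floor[of "snd p" "snd p0"] c0 p(2) by (auto simp: cell_def)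
  qed
  then have "card (cell w ` P) \<le> card ({i0 - m..i0 + m} \<times> {j0 - m..j0 + m})"
    by (intro card_mono) auto
  also have "\<dots> = nat (2 * m + 1) * nat (2 * m + 1)" by (simp add: card_cartesian_product algebra_simps)
  finally have "real (card (cell w ` P)) \<le> real (nat (2 * m + 1)) * real (nat (2 * m + 1))"
    by (metis of_nat_le_iff of_nat_mult)
  also have "\<dots> \<le> (3 * t) * (3 * t)"
  proof -
    have "m \<ge> 0" "real_of_int m \<le> t + 1" using assms(2) by (auto simp: m_def)
    then have "real (nat (2 * m + 1)) \<le> 3 * t" using assms(2) by simp
    then show ?thesis using assms(2) by (intro mult_mono) auto
  qed
  finally show ?thesis by (simp add: power2_eq_square)
qed (use assms in auto)

text \<open>Cells with at most \<open>80 ^ k\<close> points hold at most half of \<open>P\<close> by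
  the choice of \<open>k\<close>. The other half lies in dense cells, each with at most
  \<open>81 ^ k\<close> points.\<close>

lemma card_le_dense_cells:
  assumes \<alpha>: "\<alpha> > 0" and k: "(80 / 81) ^ k \<le> 1 / (162 * \<alpha>\<^sup>2)"
    and P: "alpha_dense \<alpha> P" and n: "real (card P) \<ge> (9 ^ k / \<alpha>)\<^sup>2"
    and w: "w = 9 ^ k * (min_dist P / 3)" and inj: "inj_on (cell (min_dist P / 3)) P"
  shows "real (card P) \<le> 2 * 81 ^ k * real (card {c \<in> cell w ` P. card {p \<in> P. cell w p = c} > 80 ^ k})"
proof -
  let ?n = "real (card P)"
  let ?C = "cell w ` P"
  let ?G = "{c \<in> ?C. card {p \<in> P. cell w p = c} > 80 ^ k}"
  note min = alpha_dense_min_dist[OF P]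
  have fin: "finite P" using P by (simp add: alpha_dense_def)
  have w0: "w > 0" unfolding w using min(1) by simp
  \<comment> \<open>The density bound on the diameter, in units of \<open>w\<close>; the lower bound
    on \<open>card P\<close> ensures \<open>t \<ge> 3\<close>.\<close>
  define t where "t = 3 * \<alpha> * sqrt ?n / 9 ^ k"
  have "9 ^ k / \<alpha> \<le> sqrt ?n" using n by (intro real_le_rsqrt)
  then have t3: "t \<ge> 3" using \<alpha> by (simp add: t_def field_simps)
  have tw: "t * w = \<alpha> * sqrt ?n * min_dist P" by (simp add: t_def w)
  have "dist p q \<le> t * w" if "p \<in> P" "q \<in> P" for p q
    using diameter_bounded_bound[OF finite_imp_bounded[OF fin] that] P unfolding tw
    by (simp add: alpha_dense_def)
  then have C: "real (card ?C) \<le> 9 * t\<^sup>2" by (intro card_cells_le[OF w0 t3])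
  have "card P \<le> card (\<Union>c\<in>?C. {p \<in> P. cell w p = c})" using fin by (intro card_mono) auto
  also have "\<dots> \<le> (\<Sum>c\<in>?C. card {p \<in> P. cell w p = c})" using fin by (intro card_UN_le) simp
  also have "\<dots> = (\<Sum>c\<in>?G. card {p \<in> P. cell w p = c}) + (\<Sum>c\<in>?C - ?G. card {p \<in> P. cell w p = c})"
    using fin by (subst sum.subset_diff[of ?G ?C]) (auto simp: add.commute)
  also have "(\<Sum>c\<in>?G. card {p \<in> P. cell w p = c}) \<le> (\<Sum>c\<in>?G. 81 ^ k)"
    unfolding w by (intro sum_mono card_cell_le[OF fin inj])
  also have "(\<Sum>c\<in>?C - ?G. card {p \<in> P. cell w p = c}) \<le> (\<Sum>c\<in>?C - ?G. 80 ^ k)"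
    by (intro sum_mono) (auto simp: not_less)
  also have "(\<Sum>c\<in>?C - ?G. (80::nat) ^ k) \<le> (\<Sum>c\<in>?C. 80 ^ k)"
    using fin by (intro sum_mono2) auto
  finally have "card P \<le> card ?G * 81 ^ k + card ?C * 80 ^ k" by simp
  then have "?n \<le> real (card ?G * 81 ^ k + card ?C * 80 ^ k)" by (simp only: of_nat_le_iff)
  then have le: "?n \<le> real (card ?G) * 81 ^ k + real (card ?C) * 80 ^ k" by simp
  have "real (card ?C) * 80 ^ k \<le> 9 * t\<^sup>2 * 80 ^ k" using C by (intro mult_right_mono) auto
  also have "\<dots> = 81 * \<alpha>\<^sup>2 * ?n * (80 / 81) ^ k"
    by (simp add: t_def power_mult_distrib power_divide flip: power_mult) (simp add: power_mult mult.commute[of k 2])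
  also have "\<dots> \<le> 81 * \<alpha>\<^sup>2 * ?n * (1 / (162 * \<alpha>\<^sup>2))" using k by (intro mult_left_mono) auto
  also have "\<dots> = ?n / 2" using \<alpha> by (simp add: field_simps)
  finally have "?n \<le> 2 * (real (card ?G) * 81 ^ k)" using le by linarith
  then show ?thesis by (simp only: mult_ac)
qed

theorem theorem7:
  fixes \<alpha> :: real
  assumes "\<alpha> \<ge> sqrt 2 * root 4 3 / sqrt pi"
  shows "\<exists>c > 0. \<exists>n0 :: nat. \<forall>P :: point set.
           generic P \<and> alpha_dense \<alpha> P \<and> card P \<ge> n0 \<longrightarrow> real (cr P) \<ge> c * real (card P)"
proof -
  have "0 < sqrt 2 * root 4 3 / sqrt pi" by simp
  then have \<alpha>: "\<alpha> > 0" using assms by linarith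
  \<comment> \<open>There are at most
    \<open>9 * t\<^sup>2 = 81 * \<alpha>\<^sup>2 * n / 81 ^ k\<close> cells, where
    \<open>n = card P\<close>, so this \<open>k\<close> leaves at most \<open>n / 2\<close> points
    in sparse cells.\<close>
  obtain k where k: "(80 / 81) ^ k < 1 / (162 * \<alpha>\<^sup>2)"
    using real_arch_pow_inv[of "1 / (162 * \<alpha>\<^sup>2)" "80 / 81"] \<alpha> by auto
  obtain n0 :: nat where n0: "(9 ^ k / \<alpha>)\<^sup>2 \<le> real n0" using real_arch_simple by blast
  \<comment> \<open>The constant combines \<open>2 * 81 ^ k\<close> points per dense cell with 27
    dense cells per crossing.\<close>
  have "real (cr P) \<ge> 1 / (54 * 81 ^ k) * real (card P)"
    if P: "generic P" "alpha_dense \<alpha> P" "card P \<ge> n0" for P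
  proof -
    \<comment> \<open>Two points in one cell of side \<open>h\<close> are at distance at most
      \<open>2 * h\<close>, less than the minimum distance, so each such cell holds at most one
      point.\<close>
    define h where "h = min_dist P / 3"
    define G where "G = {c \<in> cell (9 ^ k * h) ` P. card {p \<in> P. cell (9 ^ k * h) p = c} > 80 ^ k}"
    note min = alpha_dense_min_dist[OF P(2)]
    have fin: "finite P" using P by (simp add: generic_def)
    have h: "h > 0" using min(1) by (simp add: h_def)
    have inj: "inj_on (cell h) P"
    proof (rule inj_onI, rule ccontr)
      fix p q
      assume pq: "p \<in> P" "q \<in> P" "cell h p = cell h q" "p \<noteq> q"
      have "min_dist P \<le> 2 * h"
        using min(2)[OF pq(1,2,4)] dist_le_same_cell[OF h pq(3) refl] by linarith
      then show False using min(1) by (simp add: h_def)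
    qed
    have "spanning_tree P (MST P)"
      using generic_MST(1)[OF P(1) subset_refl] by (simp add: is_MST_def)
    then have "card G \<le> 27 * cr P"
      using dense_cell_crossed[OF fin inj h] h fin
      by (intro card_crossed_cells_le_cr[OF P(1), of "9 ^ k * h"]) (simp_all add: G_def)
    moreover have "real (card P) \<le> 2 * 81 ^ k * real (card G)"
      unfolding G_def h_def
      using inj n0 P(3) k by (intro card_le_dense_cells[OF \<alpha> _ P(2)]) (auto simp: h_def)
    ultimately have "real (card P) \<le> 2 * 81 ^ k * real (27 * cr P)"
      by (meson mult_left_mono of_nat_mono order_trans zero_le_numeral zero_le_power mult_nonneg_nonneg)
    then show ?thesis by (simp add: field_simps)
  qed
  then show ?thesis by (intro exI[of _ "1 / (54 * 81 ^ k)"] conjI exI[of _ n0]) auto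
qed

end
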